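(* Let $n\ge 2$ be an integer, let $k:S^1\to S^1$ be an orientation preserving homeomorphism of the circle, and let $f_0,h_k$ be the homeomorphisms of $\mathbb T^2=(\mathbb R\cup\{\infty\})\times S^1$ given by $f_0(x,\theta)=(x+1,\theta)$ and $h_k(x,\theta)=(nx,k(\theta))$ (with $\infty+1=\infty$ and $n\cdot\infty=\infty$). Then: (i) the group $\langle f_0,h_k\rangle$ generated by $f_0$ and $h_k$ is isomorphic to $BS(1,n)$; (ii) if the rotation number of $k$ is rational, there exist finite orbits of the action of $\langle f_0,h_k\rangle$ on $\mathbb T^2$; (iii) if the rotation number of $k$ is irrational, there are no finite orbits of the action of $\langle f_0,h_k\rangle$, and this action has a unique minimal set, which is included in $\{\infty\}\times S^1=\mathrm{fix}(f_0)$.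
   Context: $BS(1,n)=\langle a,b\mid aba^{-1}=b^n\rangle$. The circle $\mathbb R\cup\{\infty\}$ is the real projective line and $S^1=\mathbb R/\mathbb Z$. For a map $g$, $\mathrm{fix}(g)$ is its set of fixed points. A minimal set of an action of a group $G$ on a compact metric space $X$ is a non-empty closed $G$-invariant subset $M\subset X$ such that any closed $G$-invariant $K\subset M$ satisfies $K=M$ or $K=\emptyset$. *)

theory Defs
  imports
    "HOL-Analysis.Analysis"
    "HOL-Algebra.Generated_Groups"
    "HOL-Algebra.Group_Action"
begin

section \<open>The circle and rotation numbers\<close>

quotient_type circle = real / "\<lambda>x y. x - y \<in> \<int>"
  morphisms rep_circle circle_of
proof (rule equivpI)
  show "reflp (\<lambda>x y::real. x - y \<in> \<int>)"
    by (rule reflpI) simp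
  show "symp (\<lambda>x y::real. x - y \<in> \<int>)"
  proof (rule sympI)
    fix x y :: real
    assume "x - y \<in> \<int>"
    then have "- (x - y) \<in> \<int>"
      by (rule Ints_minus)
    then show "y - x \<in> \<int>"
      by (simp only: minus_diff_eq)
  qed
  show "transp (\<lambda>x y::real. x - y \<in> \<int>)"
  proof (rule transpI)
    fix x y z :: real
    assume "x - y \<in> \<int>" "y - z \<in> \<int>"
    then have "(x - y) + (y - z) \<in> \<int>"
      by (rule Ints_add)
    then show "x - z \<in> \<int>"
      by simp
  qed
qed

instantiation circle :: topological_space
begin

definition open_circle :: "circle set \<Rightarrow> bool"
  where "open_circle U \<longleftrightarrow> open (circle_of -` U)"

instance
  by standard (auto simp: open_circle_def vimage_Union)

end

lemma quotient_map_circle_of: "quotient_map euclidean euclidean circle_of"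
proof -
  have "range circle_of = UNIV"
    by (metis Quotient3_abs_rep Quotient3_circle surj_def)
  then show ?thesis
    by (simp add: quotient_map_def open_circle_def vimage_def)
qed

definition is_lift :: "(real \<Rightarrow> real) \<Rightarrow> (circle \<Rightarrow> circle) \<Rightarrow> bool"
  where "is_lift F k \<longleftrightarrow> continuous_on UNIV F \<and> (\<forall>x. circle_of (F x) = k (circle_of x))"

definition orientation_preserving_homeo :: "(circle \<Rightarrow> circle) \<Rightarrow> bool"
  where "orientation_preserving_homeo k \<longleftrightarrow>
    homeomorphic_map euclidean euclidean k \<and> (\<exists>F. is_lift F k \<and> strict_mono F)"

definition translation_number :: "(real \<Rightarrow> real) \<Rightarrow> real"
  where "translation_number F = lim (\<lambda>m. (F ^^ m) 0 / real m)"

text \<open>For an orientation preserving homeomorphism, the limit above exists (and the base point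
  \<open>0\<close> is immaterial) for each increasing lift, and two increasing lifts differ by an
  integer constant; so the choice of the lift does not matter modulo \<open>\<int>\<close>.\<close>

definition rotation_number :: "(circle \<Rightarrow> circle) \<Rightarrow> circle"
  where "rotation_number k = circle_of (translation_number (SOME F. is_lift F k \<and> strict_mono F))"

definition rational_class :: "circle \<Rightarrow> bool"
  where "rational_class r \<longleftrightarrow> r \<in> circle_of ` \<rat>"


section \<open>The torus and the two homeomorphisms\<close>

text \<open>The circle \<open>\<real> \<union> {\<infinity>}\<close> is the one-point compactification of the line, on the
  type \<^typ>\<open>real option\<close> with \<^const>\<open>None\<close> in the role of \<open>\<infinity>\<close>; \<^const>\<open>map_option\<close> fixes it.\<close>

abbreviation pt_infinity :: "real option"
  where "pt_infinity \<equiv> None"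

definition torus :: "(real option \<times> circle) topology"
  where "torus = prod_topology (Alexandroff_compactification euclidean) euclidean"

definition f0 :: "real option \<times> circle \<Rightarrow> real option \<times> circle"
  where "f0 = (\<lambda>(x, \<theta>). (map_option (\<lambda>t. t + 1) x, \<theta>))"

definition hk :: "nat \<Rightarrow> (circle \<Rightarrow> circle) \<Rightarrow> real option \<times> circle \<Rightarrow> real option \<times> circle"
  where "hk n k = (\<lambda>(x, \<theta>). (map_option (\<lambda>t. real n * t) x, k \<theta>))"

definition fix_set :: "('x \<Rightarrow> 'x) \<Rightarrow> 'x set"
  where "fix_set g = {x. g x = x}"

lemma topspace_torus [simp]: "topspace torus = UNIV"
  by (simp add: torus_def flip: UNIV_option_conv)

lemma continuous_map_Alexandroff_map_option:
  assumes "homeomorphic_maps X Y g h"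
  shows "continuous_map (Alexandroff_compactification X) (Alexandroff_compactification Y) (map_option g)"
proof -
  have g: "continuous_map X Y g" and h: "continuous_map Y X h"
    and hg: "\<And>x. x \<in> topspace X \<Longrightarrow> h (g x) = x" and gh: "\<And>y. y \<in> topspace Y \<Longrightarrow> g (h y) = y"
    using assms by (auto simp: homeomorphic_maps_def)
  have gX: "g x \<in> topspace Y" if "x \<in> topspace X" for x
    using g that by (auto simp: continuous_map_def)
  have hY: "h y \<in> topspace X" if "y \<in> topspace Y" for y
    using h that by (auto simp: continuous_map_def)
  let ?A = "Alexandroff_compactification X" and ?B = "Alexandroff_compactification Y"
  show ?thesis
    unfolding continuous_map_def
  proof (intro conjI allI impI)
    show "map_option g \<in> topspace ?A \<rightarrow> topspace ?B"
      using gX by auto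
    fix V assume "openin ?B V"
    then consider U where "openin Y U" "V = Some ` U"
      | C where "compactin Y C" "closedin Y C" "V = insert None (Some ` (topspace Y - C))"
      by (auto simp: openin_Alexandroff_compactification)
    then show "openin ?A {x \<in> topspace ?A. map_option g x \<in> V}"
    proof cases
      case 1
      have "{x \<in> topspace ?A. map_option g x \<in> V} = Some ` {x \<in> topspace X. g x \<in> U}"
        using 1 by auto
      then show ?thesis
        using g 1 by (simp add: continuous_map_def)
    next
      case 2
      have C: "C \<subseteq> topspace Y"
        using 2 closedin_subset by blast
      have eq: "h ` C = {x \<in> topspace X. g x \<in> C}"
        using C hg gh hY by force
      have "compactin X (h ` C)"
        using 2 h image_compactin by blast
      moreover have "closedin X (h ` C)"
        unfolding eq using g 2 closedin_continuous_map_preimage by blast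
      moreover have "{x \<in> topspace ?A. map_option g x \<in> V}
          = insert None (Some ` (topspace X - h ` C))"
        unfolding eq using 2 gX by auto
      ultimately show ?thesis
        by (auto simp: openin_Alexandroff_compactification)
    qed
  qed
qed

lemma homeomorphic_map_Alexandroff_map_option:
  assumes "homeomorphic_maps X Y g h"
  shows "homeomorphic_maps (Alexandroff_compactification X) (Alexandroff_compactification Y)
           (map_option g) (map_option h)"
  using assms continuous_map_Alexandroff_map_option[OF assms]
    continuous_map_Alexandroff_map_option[of Y X h g]
  by (auto simp: homeomorphic_maps_def)

lemma homeomorphic_map_torus:
  assumes "homeomorphic_maps (euclidean::real topology) euclidean g g'"
    and "homeomorphic_maps (euclidean::circle topology) euclidean k k'"
  shows "homeomorphic_map torus torus (\<lambda>(x, \<theta>). (map_option g x, k \<theta>))"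
proof -
  have "homeomorphic_maps torus torus (\<lambda>(x, \<theta>). (map_option g x, k \<theta>))
          (\<lambda>(x, \<theta>). (map_option g' x, k' \<theta>))"
    unfolding torus_def homeomorphic_maps_prod
    using assms homeomorphic_map_Alexandroff_map_option by blast
  then show ?thesis
    using homeomorphic_map_maps by blast
qed

lemma homeomorphic_map_f0: "homeomorphic_map torus torus f0"
proof -
  have "homeomorphic_maps (euclidean::real topology) euclidean (\<lambda>t. t + 1) (\<lambda>t. t - 1)"
    by (auto simp: homeomorphic_maps_def continuous_map_iff_continuous2 intro!: continuous_intros)
  moreover have "homeomorphic_maps (euclidean::circle topology) euclidean (\<lambda>t. t) (\<lambda>t. t)"
    by (simp add: homeomorphic_maps_def)
  ultimately show ?thesis
    unfolding f0_def by (rule homeomorphic_map_torus)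
qed

lemma homeomorphic_map_hk:
  assumes "homeomorphic_map euclidean euclidean k" "n \<ge> 1"
  shows "homeomorphic_map torus torus (hk n k)"
proof -
  have "homeomorphic_maps (euclidean::real topology) euclidean (\<lambda>t. real n * t) (\<lambda>t. t / real n)"
    using assms
    by (auto simp: homeomorphic_maps_def continuous_map_iff_continuous2 intro!: continuous_intros)
  moreover obtain k' where "homeomorphic_maps (euclidean::circle topology) euclidean k k'"
    using assms homeomorphic_map_maps by blast
  ultimately show ?thesis
    unfolding hk_def by (rule homeomorphic_map_torus)
qed

definition torus_group :: "nat \<Rightarrow> (circle \<Rightarrow> circle) \<Rightarrow>
    (real option \<times> circle \<Rightarrow> real option \<times> circle) monoid"
  where "torus_group n k =
    (BijGroup (topspace torus))\<lparr>carrier := generate (BijGroup (topspace torus)) {f0, hk n k}\<rparr>"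


section \<open>Minimal sets\<close>

definition invariant_set :: "('g, 'm) monoid_scheme \<Rightarrow> ('g \<Rightarrow> 'x \<Rightarrow> 'x) \<Rightarrow> 'x set \<Rightarrow> bool"
  where "invariant_set G \<phi> M \<longleftrightarrow> (\<forall>g\<in>carrier G. \<phi> g ` M \<subseteq> M)"

definition minimal_set ::
    "'x topology \<Rightarrow> ('g, 'm) monoid_scheme \<Rightarrow> ('g \<Rightarrow> 'x \<Rightarrow> 'x) \<Rightarrow> 'x set \<Rightarrow> bool"
  where "minimal_set X G \<phi> M \<longleftrightarrow>
    M \<noteq> {} \<and> closedin X M \<and> invariant_set G \<phi> M \<and>
    (\<forall>K. closedin X K \<and> invariant_set G \<phi> K \<and> K \<subseteq> M \<longrightarrow> K = M \<or> K = {})"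


section \<open>Group presentations and the Baumslag--Solitar groups\<close>

text \<open>A letter \<open>(g, True)\<close> stands for the generator \<open>g\<close> and \<open>(g, False)\<close> for its inverse.
  A set \<open>R\<close> of pairs of words is a set of relations; the group presented by \<open>R\<close> consists of the
  words modulo the smallest congruence containing \<open>R\<close> and free cancellation.\<close>

type_synonym 'g gword = "('g \<times> bool) list"

inductive word_eq :: "('g gword \<times> 'g gword) set \<Rightarrow> 'g gword \<Rightarrow> 'g gword \<Rightarrow> bool"
  for R :: "('g gword \<times> 'g gword) set"
where
  refl: "word_eq R u u"
| sym: "word_eq R u v \<Longrightarrow> word_eq R v u"
| trans: "word_eq R u v \<Longrightarrow> word_eq R v w \<Longrightarrow> word_eq R u w"
| cancel: "word_eq R (u @ [(g, e), (g, \<not> e)] @ v) (u @ v)"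
| relation: "(l, r) \<in> R \<Longrightarrow> word_eq R (u @ l @ v) (u @ r @ v)"

definition word_class :: "('g gword \<times> 'g gword) set \<Rightarrow> 'g gword \<Rightarrow> 'g gword set"
  where "word_class R u = {v. word_eq R u v}"

definition presented_group :: "('g gword \<times> 'g gword) set \<Rightarrow> 'g gword set monoid"
  where "presented_group R =
    \<lparr>carrier = range (word_class R),
     mult = (\<lambda>A B. \<Union>u\<in>A. \<Union>v\<in>B. word_class R (u @ v)),
     one = word_class R []\<rparr>"

lemma word_class_eq_iff: "word_class R u = word_class R v \<longleftrightarrow> word_eq R u v"
proof
  assume "word_class R u = word_class R v"
  moreover have "v \<in> word_class R v"
    by (simp add: word_class_def word_eq.refl)
  ultimately have "v \<in> word_class R u"
    by simp
  then show "word_eq R u v"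
    by (simp add: word_class_def)
next
  assume uv: "word_eq R u v"
  have "word_eq R u w \<longleftrightarrow> word_eq R v w" for w
    using word_eq.trans[OF uv, of w] word_eq.trans[OF word_eq.sym[OF uv], of w] by iprover
  then show "word_class R u = word_class R v"
    by (simp add: word_class_def)
qed

lemma word_eq_context:
  assumes "word_eq R u v" shows "word_eq R (p @ u @ q) (p @ v @ q)"
  using assms
proof induction
  case (cancel u g e v)
  then show ?case using word_eq.cancel[of R "p @ u" g e "v @ q"] by simp
next
  case (relation l r u v)
  then show ?case using word_eq.relation[of l r R "p @ u" "v @ q"] by simp
next
  case (refl u)
  show ?case by (rule word_eq.refl)
next
  case (sym u v)
  show ?case by (rule word_eq.sym) (rule sym.IH)
next
  case (trans u v w)
  show ?case by (rule word_eq.trans[OF trans.IH])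
qed

lemma word_eq_append:
  assumes "word_eq R u u'" "word_eq R v v'" shows "word_eq R (u @ v) (u' @ v')"
proof (rule word_eq.trans)
  show "word_eq R (u @ v) (u' @ v)"
    using word_eq_context[OF assms(1), of "[]" v] by simp
  show "word_eq R (u' @ v) (u' @ v')"
    using word_eq_context[OF assms(2), of u' "[]"] by simp
qed

lemma mult_presented_group:
  "word_class R u \<otimes>\<^bsub>presented_group R\<^esub> word_class R v = word_class R (u @ v)"
proof -
  have "word_class R (u' @ v') = word_class R (u @ v)"
    if "u' \<in> word_class R u" "v' \<in> word_class R v" for u' v'
    using that word_eq_append[of R u u' v v'] word_class_eq_iff[of R "u @ v" "u' @ v'"]
    by (simp add: word_class_def)
  moreover have "word_class R u \<noteq> {}" "word_class R v \<noteq> {}"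
    using word_eq.refl by (auto simp: word_class_def)
  ultimately have "(\<Union>u'\<in>word_class R u. \<Union>v'\<in>word_class R v. word_class R (u' @ v'))
      = word_class R (u @ v)"
    by simp
  then show ?thesis
    by (simp add: presented_group_def)
qed

lemma word_eq_inverse: "word_eq R (rev (map (apsnd Not) u) @ u) []"
proof (induction u)
  case Nil
  then show ?case by (simp add: word_eq.refl)
next
  case (Cons a u)
  obtain g e where a: "a = (g, e)" by (cases a)
  have "word_eq R (rev (map (apsnd Not) (a # u)) @ a # u) (rev (map (apsnd Not) u) @ u)"
    using word_eq.cancel[of R "rev (map (apsnd Not) u)" g "\<not> e" u] by (simp add: a)
  then show ?case by (rule word_eq.trans) (rule Cons.IH)
qed

lemma group_presented_group: "group (presented_group R)"
proof (rule groupI)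
  fix x assume "x \<in> carrier (presented_group R)"
  then obtain u where u: "x = word_class R u"
    by (auto simp: presented_group_def)
  have "word_class R (rev (map (apsnd Not) u)) \<otimes>\<^bsub>presented_group R\<^esub> x = word_class R []"
    by (simp add: u mult_presented_group word_class_eq_iff word_eq_inverse)
  then show "\<exists>y\<in>carrier (presented_group R). y \<otimes>\<^bsub>presented_group R\<^esub> x = \<one>\<^bsub>presented_group R\<^esub>"
    by (auto simp: presented_group_def)
next
  have carr: "carrier (presented_group R) = range (word_class R)"
    and one: "\<one>\<^bsub>presented_group R\<^esub> = word_class R []"
    by (simp_all add: presented_group_def)
  show "\<one>\<^bsub>presented_group R\<^esub> \<in> carrier (presented_group R)"
    by (simp add: carr one)
  fix x y z
  assume "x \<in> carrier (presented_group R)" "y \<in> carrier (presented_group R)"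
  then show "x \<otimes>\<^bsub>presented_group R\<^esub> y \<in> carrier (presented_group R)"
    by (auto simp: carr mult_presented_group)
  show "\<one>\<^bsub>presented_group R\<^esub> \<otimes>\<^bsub>presented_group R\<^esub> x = x"
    if "x \<in> carrier (presented_group R)" for x
    using that by (auto simp: carr one mult_presented_group)
  show "x \<otimes>\<^bsub>presented_group R\<^esub> y \<otimes>\<^bsub>presented_group R\<^esub> z
      = x \<otimes>\<^bsub>presented_group R\<^esub> (y \<otimes>\<^bsub>presented_group R\<^esub> z)"
    if "x \<in> carrier (presented_group R)" "y \<in> carrier (presented_group R)"
       "z \<in> carrier (presented_group R)" for x y z
    using that by (auto simp: carr mult_presented_group)
qed

datatype bs_gen = BS_a | BS_b

definition BS1 :: "nat \<Rightarrow> bs_gen gword set monoid"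
  where "BS1 n = presented_group
    {([(BS_a, True), (BS_b, True), (BS_a, False)], replicate n (BS_b, True))}"

end

theory Submission
  imports Defs
begin

text \<open>
  The map \<open>f0\<close> is the translation by \<open>1\<close> and \<open>hk n k\<close> the
  dilation by \<open>n\<close> on the first factor \<open>\<real> \<union> {\<infinity>}\<close>;
  on the second factor \<open>f0\<close> is the identity and \<open>hk n k\<close> is
  \<open>k\<close>.

  \<^emph>\<open>The group.\<close> The dilation conjugates the translation to its
  \<open>n\<close>-th power, so the two maps define a homomorphism from \<open>BS(1,n)\<close>
  onto the group that they generate. In \<open>BS(1,n)\<close> every element has the form
  \<open>a\<^bsup>-i\<^esup> b\<^bsup>m\<^esup> a\<^bsup>j\<^esup>\<close>
  (\<open>generate_normal_form\<close>), which acts on the line by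
  \<open>t \<mapsto> n\<^bsup>-i\<^esup> (n\<^bsup>j\<^esup> t + m)\<close>. This is the identity
  only if \<open>m = 0\<close> and \<open>i = j\<close>, so the homomorphism is injective
  (\<open>presented_hom_kernel\<close>).

  \<^emph>\<open>Finite orbits.\<close> On the circle at infinity the group acts through the
  powers of \<open>k\<close>. If the rotation number is rational, then \<open>k\<close> has a
  periodic point (\<open>periodic_point_if_rational\<close>), and its orbit at infinity is finite.
  Conversely, a finite orbit on the torus projects to a set containing a \<open>k\<close>-orbit,
  so some \<open>k\<close>-orbit repeats a point, and the rotation number is rational
  (\<open>rational_if_orbit_repeats\<close>). Both facts come from the estimate that the
  displacement of the \<open>m\<close>-th iterate of a lift is \<open>m\<close> times the
  translation number, up to an error bounded independently of \<open>m\<close> and of the point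
  (\<open>displacement_near_translation\<close>).

  \<^emph>\<open>Minimal sets.\<close> Translations push every point towards infinity, so every
  non-empty closed invariant set meets the circle at infinity
  (\<open>closed_f0_invariant_meets_infinity\<close>) in a closed \<open>k\<close>-invariant set.
  For irrational rotation number any two non-empty closed \<open>k\<close>-invariant sets meet
  (\<open>closed_invariant_sets_meet\<close>): otherwise a gap of one of them would have
  infinitely many disjoint images on the circle, none shorter than the distance of the two sets.
  By compactness there is then a least non-empty closed \<open>k\<close>-invariant set, and at
  infinity it is the unique minimal set.
\<close>

section \<open>The circle as a quotient of the line\<close>

lemma circle_of_eq_iff: "circle_of x = circle_of y \<longleftrightarrow> x - y \<in> \<int>"
  by (simp add: circle.abs_eq_iff)

lemma surj_circle_of: "surj circle_of"
  by (metis Quotient3_abs_rep Quotient3_circle surj_def)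

lemma continuous_on_circle_of: "continuous_on S circle_of"
  by (rule continuous_on_subset[of UNIV]) (auto simp: continuous_on_open_vimage open_circle_def)

lemma closed_circle_of_vimage: "closed K \<Longrightarrow> closed (circle_of -` K)"
  using continuous_on_circle_of[of UNIV] by (simp add: continuous_on_closed_vimage)

lemma circle_of_fundamental_domain:
  obtains x where "0 \<le> x" "x < 1" "circle_of x = \<theta>"
proof -
  obtain y where y: "circle_of y = \<theta>"
    using surj_circle_of by (metis surj_def)
  have "circle_of (frac y) = \<theta>"
    unfolding y[symmetric] circle_of_eq_iff by (simp add: frac_def)
  then show thesis
    using that[of "frac y"] frac_ge_0 frac_lt_1 by blast
qed

lemma compact_UNIV_circle: "compact (UNIV :: circle set)"
proof -
  have "UNIV = circle_of ` {0..1}"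
  proof (intro equalityI subsetI)
    fix \<theta> :: circle
    obtain x where "0 \<le> x" "x < 1" "circle_of x = \<theta>"
      by (rule circle_of_fundamental_domain)
    then show "\<theta> \<in> circle_of ` {0..1}"
      by (intro image_eqI[of _ _ x]) simp_all
  qed simp
  then show ?thesis
    using compact_continuous_image[OF continuous_on_circle_of compact_Icc[of "0::real" 1]] by simp
qed

lemma rational_class_circle_of: "rational_class (circle_of r) \<longleftrightarrow> r \<in> \<rat>"
proof
  assume "rational_class (circle_of r)"
  then obtain s where "s \<in> \<rat>" "r - s \<in> \<int>"
    by (auto simp: rational_class_def circle_of_eq_iff)
  then have "(r - s) + s \<in> \<rat>"
    by (intro Rats_add) (auto elim: Ints_cases)
  then show "r \<in> \<rat>" by simp
qed (auto simp: rational_class_def)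

section \<open>Lemmas on the real line\<close>

text \<open>The Archimedean principle in the form that turns a bound on \<open>m\<close> times a
  quantity, uniform in \<open>m\<close>, into a bound on the quantity itself: errors that stay
  bounded under iteration disappear.\<close>

lemma nonpos_if_multiples_bounded:
  fixes c :: real
  assumes "\<And>m::nat. real m * c \<le> C"
  shows "c \<le> 0"
proof (rule ccontr)
  assume "\<not> c \<le> 0"
  then obtain m where "C < real m * c"
    using reals_Archimedean3[of c] by auto
  with assms[of m] show False
    by simp
qed

text \<open>Neither set is compact, but an integer translation, which maps both of them into
  themselves, brings any point of \<open>A\<close> into the unit interval. The preimages in
  \<open>\<real>\<close> of two disjoint closed subsets of the circle are sets of this
  kind.\<close>

lemma closed_periodic_sets_apart:
  fixes A B :: "real set"
  assumes "closed A" "closed B" "A \<inter> B = {}"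
    and A: "\<And>x p. x \<in> A \<Longrightarrow> x + of_int p \<in> A" and B: "\<And>x p. x \<in> B \<Longrightarrow> x + of_int p \<in> B"
  obtains \<delta> where "\<delta> > 0" "\<And>x y. x \<in> A \<Longrightarrow> y \<in> B \<Longrightarrow> \<delta> \<le> \<bar>x - y\<bar>"
proof -
  have "compact (A \<inter> {0..1})"
    using \<open>closed A\<close> by (simp add: closed_Int_compact)
  then obtain \<delta> where \<delta>: "\<delta> > 0" "\<And>x y. x \<in> A \<inter> {0..1} \<Longrightarrow> y \<in> B \<Longrightarrow> \<delta> \<le> \<bar>x - y\<bar>"
    using separate_compact_closed[of "A \<inter> {0..1}" B] assms(2,3) unfolding dist_real_def by blast
  have "\<delta> \<le> \<bar>x - y\<bar>" if "x \<in> A" "y \<in> B" for x y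
  proof -
    have "x + of_int (- \<lfloor>x\<rfloor>) \<in> A \<inter> {0..1}"
      using A[OF \<open>x \<in> A\<close>, of "- \<lfloor>x\<rfloor>"] by (simp add: le_diff_eq) linarith
    from \<delta>(2)[OF this B[OF \<open>y \<in> B\<close>, of "- \<lfloor>x\<rfloor>"]] show ?thesis
      by simp
  qed
  then show thesis
    using that \<delta>(1) by blast
qed

lemma no_sequence_of_separated_points:
  fixes y :: "nat \<Rightarrow> real"
  assumes "bounded (range y)" "\<delta> > 0"
  shows "\<exists>l m. l < m \<and> \<bar>y m - y l\<bar> < \<delta>"
proof -
  obtain z r where r: "strict_mono r" "(y \<circ> r) \<longlonglongrightarrow> z"
    using bounded_imp_convergent_subsequence[OF assms(1)] by auto
  then have "Cauchy (y \<circ> r)"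
    by (meson LIMSEQ_imp_Cauchy)
  then obtain N where "\<forall>i\<ge>N. \<forall>j\<ge>N. dist ((y \<circ> r) i) ((y \<circ> r) j) < \<delta>"
    using \<open>\<delta> > 0\<close> unfolding Cauchy_def by blast
  then have "dist ((y \<circ> r) (Suc N)) ((y \<circ> r) N) < \<delta>"
    by simp
  moreover have "r N < r (Suc N)"
    using r(1) by (simp add: strict_mono_def)
  ultimately show ?thesis
    by (auto simp: dist_real_def)
qed

section \<open>Translation numbers of increasing lifts\<close>

text \<open>Injectivity of \<open>k\<close> is what forces the lift to have degree one.\<close>

locale increasing_lift =
  fixes F :: "real \<Rightarrow> real" and k :: "circle \<Rightarrow> circle"
  assumes lift: "is_lift F k" and mono: "strict_mono F" and inj: "inj k"
begin

text \<open>The displacement is a \<open>1\<close>-periodic function of the point, so it descends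
  to the circle, and it is additive along orbits. Everything about the translation number is read
  off from it.\<close>

definition displacement :: "nat \<Rightarrow> real \<Rightarrow> real"
  where "displacement m x = (F ^^ m) x - x"

lemma circle_of_lift: "circle_of (F x) = k (circle_of x)"
  using lift by (simp add: is_lift_def)

lemma circle_of_funpow: "circle_of ((F ^^ m) x) = (k ^^ m) (circle_of x)"
  by (induction m) (simp_all add: circle_of_lift)

lemma continuous_funpow: "continuous_on S (F ^^ m)"
proof (rule continuous_on_subset[of UNIV])
  have F: "continuous_on UNIV F"
    using lift by (simp add: is_lift_def)
  show "continuous_on UNIV (F ^^ m)"
  proof (induction m)
    case (Suc m)
    have "continuous_on UNIV (\<lambda>x. F ((F ^^ m) x))"
      by (rule continuous_on_compose2[OF F Suc]) simp
    then show ?case by (simp add: o_def)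
  qed (simp add: id_def)
qed simp

lemma strict_mono_funpow: "strict_mono (F ^^ m)"
proof (induction m)
  case (Suc m)
  then show ?case
    using mono by (auto simp: strict_mono_def)
qed (auto simp: strict_mono_def)

text \<open>The lift has degree one. The difference \<open>F (x + 1) - F x\<close> is a positive
  integer; were it at least \<open>2\<close>, then \<open>F\<close> would take the value
  \<open>F x + 1\<close> strictly between \<open>x\<close> and \<open>x + 1\<close>, and
  \<open>k\<close> would identify two distinct points of the circle.\<close>

lemma lift_plus_one: "F (x + 1) = F x + 1"
proof -
  have "circle_of (x + 1) = circle_of x"
    by (simp add: circle_of_eq_iff)
  then have "F (x + 1) - F x \<in> \<int>"
    by (simp add: circle_of_lift flip: circle_of_eq_iff)
  then obtain d where d: "F (x + 1) - F x = of_int d"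
    by (auto elim: Ints_cases)
  have "F x < F (x + 1)"
    using mono by (simp add: strict_mono_def)
  with d have "d \<ge> 1"
    by linarith
  moreover have "\<not> d > 1"
  proof
    assume "d > 1"
    with d have gt: "F x + 1 < F (x + 1)"
      by linarith
    then have "\<exists>y\<ge>x. y \<le> x + 1 \<and> F y = F x + 1"
      using continuous_funpow[of "{x..x+1}" 1] by (intro IVT') auto
    then obtain y where y: "x \<le> y" "y \<le> x + 1" "F y = F x + 1"
      by blast
    then have "k (circle_of y) = k (circle_of x)"
      by (simp add: circle_of_eq_iff flip: circle_of_lift)
    then have "y - x \<in> \<int>"
      using inj by (simp add: inj_eq circle_of_eq_iff)
    then obtain j where "y - x = of_int j"
      by (auto elim: Ints_cases)
    with y have "j = 0 \<or> j = 1"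
      by linarith
    with \<open>y - x = of_int j\<close> have "y = x \<or> y = x + 1"
      by auto
    with y gt show False
      by auto
  qed
  ultimately show ?thesis
    using d by simp
qed

lemma lift_plus_nat: "F (x + real p) = F x + real p"
proof (induction p)
  case (Suc p)
  then show ?case
    using lift_plus_one[of "x + real p"] by (simp add: algebra_simps)
qed simp

lemma funpow_plus_int: "(F ^^ m) (x + of_int p) = (F ^^ m) x + of_int p"
proof (induction m)
  case (Suc m)
  have "F (y + of_int p) = F y + of_int p" for y
    using lift_plus_nat[of y "nat p"] lift_plus_nat[of "y + of_int p" "nat (- p)"]
    by (cases "p \<ge> 0") auto
  then show ?case by (simp add: Suc)
qed simp

lemma displacement_plus_int: "displacement m (x + of_int p) = displacement m x"
  by (simp add: displacement_def funpow_plus_int)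

text \<open>Translating \<open>y\<close> by an integer puts \<open>x\<close> between
  \<open>y'\<close> and \<open>y' + 1\<close>. Monotonicity then puts the images between two
  points at distance \<open>1\<close> as well.\<close>

lemma displacement_variation: "\<bar>displacement m x - displacement m y\<bar> \<le> 1"
proof -
  define y' where "y' = y + of_int \<lfloor>x - y\<rfloor>"
  have y': "y' \<le> x" "x < y' + 1"
    unfolding y'_def by linarith+
  have "(F ^^ m) y' \<le> (F ^^ m) x" "(F ^^ m) x \<le> (F ^^ m) (y' + 1)"
    using y' strict_mono_funpow[of m] by (simp_all add: strict_mono_less_eq)
  moreover have "(F ^^ m) (y' + 1) = (F ^^ m) y' + 1"
    using funpow_plus_int[of m y' 1] by simp
  moreover have "displacement m y = displacement m y'"
    by (simp add: y'_def displacement_plus_int)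
  ultimately show ?thesis
    using y' by (simp add: displacement_def abs_le_iff)
qed

lemma displacement_add: "displacement (m + l) x = displacement m ((F ^^ l) x) + displacement l x"
  by (simp add: displacement_def funpow_add)

text \<open>The displacement is a quasimorphism: additive along an orbit, and by
  \<open>displacement_variation\<close> the summands depend on the point only up to an error of
  \<open>1\<close>.\<close>

lemma displacement_mult: "\<bar>displacement (l * m) x - real l * displacement m x\<bar> \<le> real l"
proof (induction l)
  case (Suc l)
  have "displacement (Suc l * m) x = displacement m ((F ^^ (l * m)) x) + displacement (l * m) x"
    by (simp add: displacement_add)
  then show ?case
    using Suc displacement_variation[of m "(F ^^ (l * m)) x" x]
    by (simp add: algebra_simps abs_le_iff)
qed (simp add: displacement_def)

text \<open>Both displacements are compared with that of the iterate of order
  \<open>l * m\<close>.\<close>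

lemma displacement_cross: "\<bar>real l * displacement m x - real m * displacement l x\<bar> \<le> real l + real m"
  using displacement_mult[of l m x] displacement_mult[of m l x]
  by (simp add: mult.commute abs_le_iff)

lemma displacement_average_close:
  assumes "m > 0" "l > 0"
  shows "\<bar>displacement m x / real m - displacement l x / real l\<bar> \<le> 1 / real m + 1 / real l"
proof -
  have "\<bar>displacement m x / real m - displacement l x / real l\<bar>
      = \<bar>real l * displacement m x - real m * displacement l x\<bar> / (real l * real m)"
    using assms by (simp add: divide_simps abs_mult mult.commute)
  also have "\<dots> \<le> (real l + real m) / (real l * real m)"
    using displacement_cross assms by (intro divide_right_mono) auto
  also have "\<dots> = 1 / real m + 1 / real l"
    using assms by (simp add: divide_simps)
  finally show ?thesis .
qed

text \<open>The mean displacements form a Cauchy sequence, so the limit that defines the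
  translation number exists.\<close>

lemma translation_number_LIMSEQ: "(\<lambda>m. displacement m 0 / real m) \<longlonglongrightarrow> translation_number F"
proof -
  have "Cauchy (\<lambda>m. displacement m 0 / real m)"
  proof (rule metric_CauchyI)
    fix e :: real assume "e > 0"
    then obtain M :: nat where M: "M > 0" "1 / real M < e / 2"
      using real_arch_inverse[of "e / 2"] by (auto simp: inverse_eq_divide)
    have "dist (displacement m 0 / real m) (displacement l 0 / real l) < e"
      if "m \<ge> M" "l \<ge> M" for m l
    proof -
      have "1 / real m \<le> 1 / real M" "1 / real l \<le> 1 / real M"
        using that M by (simp_all add: frac_le)
      then show ?thesis
        using displacement_average_close[of m l 0] that M by (simp add: dist_real_def)
    qed
    then show "\<exists>M. \<forall>m\<ge>M. \<forall>n\<ge>M. dist (displacement m 0 / real m) (displacement n 0 / real n) < e"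
      by blast
  qed
  then have "convergent (\<lambda>m. displacement m 0 / real m)"
    by (simp add: Cauchy_convergent_iff)
  then show ?thesis
    by (simp add: convergent_LIMSEQ_iff translation_number_def displacement_def)
qed

text \<open>Letting the second index of \<open>displacement_average_close\<close> tend to infinity
  keeps the error bounded after multiplication by \<open>m\<close>. This uniform estimate replaces
  all further use of limits.\<close>

lemma displacement_near_translation: "\<bar>displacement m x - real m * translation_number F\<bar> \<le> 2"
proof -
  have "\<bar>displacement m 0 - real m * translation_number F\<bar> \<le> 1"
  proof (cases "m = 0")
    case False
    have "(\<lambda>l. \<bar>displacement m 0 / real m - displacement l 0 / real l\<bar>)
        \<longlonglongrightarrow> \<bar>displacement m 0 / real m - translation_number F\<bar>"
      by (intro tendsto_intros translation_number_LIMSEQ)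
    moreover have "(\<lambda>l. 1 / real m + 1 / real l) \<longlonglongrightarrow> 1 / real m + 0"
      by (intro tendsto_intros lim_1_over_n)
    ultimately have "\<bar>displacement m 0 / real m - translation_number F\<bar> \<le> 1 / real m + 0"
      using displacement_average_close[of m _ 0] False
      by (intro tendsto_le[OF sequentially_bot]) (auto intro!: eventually_sequentiallyI[of 1])
    then have "real m * \<bar>displacement m 0 / real m - translation_number F\<bar> \<le> 1"
      using False by (simp add: field_simps)
    moreover have "real m * \<bar>displacement m 0 / real m - translation_number F\<bar>
        = \<bar>real m * (displacement m 0 / real m - translation_number F)\<bar>"
      by (simp add: abs_mult)
    moreover have "real m * (displacement m 0 / real m - translation_number F)
        = displacement m 0 - real m * translation_number F"
      using False by (simp add: right_diff_distrib)
    ultimately show ?thesis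
      by simp
  qed (simp add: displacement_def)
  then show ?thesis
    using displacement_variation[of m x 0] by linarith
qed

lemma translation_number_of_periodic_point:
  assumes "(F ^^ q) x = x + of_int p"
  shows "real q * translation_number F = of_int p"
proof -
  have "displacement (m * q) x = real m * of_int p" for m
  proof (induction m)
    case (Suc m)
    have "(F ^^ (m * q)) x = x + of_int (int m * p)"
      using Suc by (simp add: displacement_def)
    then have "displacement q ((F ^^ (m * q)) x) = of_int p"
      using assms by (simp only: displacement_plus_int) (simp add: displacement_def)
    then show ?case
      using displacement_add[of q "m * q" x] Suc by (simp add: algebra_simps)
  qed (simp add: displacement_def)
  then have "real m * (of_int p - real q * translation_number F) \<le> 2"
      "real m * (real q * translation_number F - of_int p) \<le> 2" for m
    using displacement_near_translation[of "m * q" x] by (simp_all add: abs_le_iff algebra_simps)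
  from this[THEN nonpos_if_multiples_bounded] show ?thesis
    by simp
qed

text \<open>A bound \<open>c\<close> on a single step of \<open>F ^^ q\<close> gives
  \<open>m * c\<close> for \<open>m\<close> steps, which the uniform estimate compares with
  \<open>m * q\<close> times the translation number.\<close>

lemma displacement_upper_bound:
  assumes "\<And>x. displacement q x \<le> c"
  shows "real q * translation_number F \<le> c"
proof -
  have "displacement (m * q) 0 \<le> real m * c" for m
  proof (induction m)
    case (Suc m)
    then show ?case
      using displacement_add[of q "m * q" 0] assms[of "(F ^^ (m * q)) 0"] by (simp add: algebra_simps)
  qed (simp add: displacement_def)
  note above = this
  have "real m * (real q * translation_number F - c) \<le> 2" for m
    using displacement_near_translation[of "m * q" 0] above[of m]
    by (simp add: algebra_simps abs_le_iff)
  from nonpos_if_multiples_bounded[OF this] show ?thesis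
    by simp
qed

lemma displacement_lower_bound:
  assumes "\<And>x. displacement q x \<ge> c"
  shows "real q * translation_number F \<ge> c"
proof -
  have "displacement (m * q) 0 \<ge> real m * c" for m
  proof (induction m)
    case (Suc m)
    then show ?case
      using displacement_add[of q "m * q" 0] assms[of "(F ^^ (m * q)) 0"] by (simp add: algebra_simps)
  qed (simp add: displacement_def)
  note below = this
  have "real m * (c - real q * translation_number F) \<le> 2" for m
    using displacement_near_translation[of "m * q" 0] below[of m]
    by (simp add: algebra_simps abs_le_iff)
  from nonpos_if_multiples_bounded[OF this] show ?thesis
    by simp
qed

lemma continuous_displacement: "continuous_on S (displacement q)"
  unfolding displacement_def by (intro continuous_intros continuous_funpow)

text \<open>Otherwise, being continuous and periodic, the displacement would stay on one side of
  \<open>q\<close> times the translation number by a definite amount, contradicting the two bounds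
  above.\<close>

lemma displacement_attained:
  obtains x where "displacement q x = real q * translation_number F"
proof -
  obtain u where u: "\<And>x. x \<in> {0..1} \<Longrightarrow> displacement q x \<le> displacement q u"
    using continuous_attains_sup[OF compact_Icc _ continuous_displacement, of 0 1 q]
    by (metis atLeastAtMost_iff empty_iff zero_le_one order_refl)
  obtain v where v: "\<And>x. x \<in> {0..1} \<Longrightarrow> displacement q v \<le> displacement q x"
    using continuous_attains_inf[OF compact_Icc _ continuous_displacement, of 0 1 q]
    by (metis atLeastAtMost_iff empty_iff zero_le_one order_refl)
  have "displacement q x = displacement q (frac x)" for x
    using displacement_plus_int[of q "frac x" "\<lfloor>x\<rfloor>"] by (simp add: frac_def)
  moreover have "frac x \<in> {0..1}" for x :: real
    using frac_ge_0[of x] frac_lt_1[of x] by simp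
  ultimately have "displacement q x \<le> displacement q u" "displacement q v \<le> displacement q x" for x
    using u v by metis+
  then have "real q * translation_number F \<in> {displacement q v..displacement q u}"
    using displacement_upper_bound displacement_lower_bound by simp
  moreover have "is_interval (range (displacement q))"
    using connected_continuous_image[OF continuous_displacement connected_UNIV]
    by (simp add: is_interval_connected_1)
  ultimately have "real q * translation_number F \<in> range (displacement q)"
    by (auto simp: is_interval_1)
  then show thesis
    using that by auto
qed

text \<open>If the translation number is \<open>p / q\<close>, then by the intermediate value
  argument some point is moved by \<open>F ^^ q\<close> by exactly the integer \<open>p\<close>,
  so its class on the circle is periodic.\<close>

lemma periodic_point_if_rational:
  assumes "translation_number F \<in> \<rat>"
  obtains q \<theta> where "q > 0" "(k ^^ q) \<theta> = \<theta>"
proof -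
  obtain p and q :: nat where "q \<noteq> 0" and pq: "\<bar>translation_number F\<bar> = real p / real q"
    using Rats_abs_nat_div_natE[OF assms] by metis
  then have "\<bar>real q * translation_number F\<bar> \<in> \<int>"
    by (simp add: abs_mult)
  then have "real q * translation_number F \<in> \<int>"
    by (simp add: abs_if split: if_splits)
  obtain x where "displacement q x = real q * translation_number F"
    by (rule displacement_attained)
  then have "circle_of ((F ^^ q) x) = circle_of x"
    using \<open>real q * translation_number F \<in> \<int>\<close> by (simp add: circle_of_eq_iff displacement_def)
  then show thesis
    using that[of q "circle_of x"] \<open>q \<noteq> 0\<close> by (simp add: circle_of_funpow)
qed

lemma rational_if_orbit_repeats:
  assumes "l < m" "(k ^^ m) \<theta> = (k ^^ l) \<theta>"
  shows "translation_number F \<in> \<rat>"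
proof -
  obtain x where x: "circle_of x = \<theta>"
    by (rule circle_of_fundamental_domain)
  have "(k ^^ (m - l)) ((k ^^ l) \<theta>) = (k ^^ m) \<theta>"
    using funpow_add[of "m - l" l k] \<open>l < m\<close> by simp
  then have "circle_of ((F ^^ (m - l)) ((F ^^ l) x)) = circle_of ((F ^^ l) x)"
    using assms(2) x by (simp add: circle_of_funpow)
  then obtain p where "(F ^^ (m - l)) ((F ^^ l) x) = (F ^^ l) x + of_int p"
    by (auto simp: circle_of_eq_iff algebra_simps elim!: Ints_cases)
  then have "real (m - l) * translation_number F = of_int p"
    by (rule translation_number_of_periodic_point)
  then have "translation_number F = of_int p / of_nat (m - l)"
    using \<open>l < m\<close> by (simp add: field_simps)
  then show ?thesis
    by (metis Rats_divide Rats_of_int Rats_of_nat)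
qed

text \<open>Suppose that the two sets are disjoint, and lift them to \<open>A\<close> and
  \<open>B\<close> in \<open>\<real>\<close>, which have distance at least some
  \<open>\<delta> > 0\<close>. Let \<open>a\<close> be the last point of \<open>B\<close> before a
  point \<open>x\<close> of \<open>A\<close>. The interval from \<open>a\<close> to
  \<open>x\<close> misses \<open>B\<close>, and so do all its images, each of which has length at
  least \<open>\<delta>\<close> because it leads from \<open>B\<close> to \<open>A\<close>. So
  each point of the orbit of \<open>a\<close>, which lies in \<open>B\<close>, is followed by a
  gap of length \<open>\<delta>\<close> without points of \<open>B\<close>. Modulo
  \<open>1\<close> this leaves room for finitely many points only: the orbit of \<open>a\<close>
  repeats, which an irrational translation number excludes.\<close>

lemma closed_invariant_sets_meet:
  assumes irr: "translation_number F \<notin> \<rat>"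
    and K: "closed K" "K \<noteq> {}" "k ` K = K" and L: "closed L" "L \<noteq> {}" "k ` L = L"
  shows "K \<inter> L \<noteq> {}"
proof
  assume disj: "K \<inter> L = {}"
  define A where "A = circle_of -` K"
  define B where "B = circle_of -` L"
  have closed: "closed A" "closed B"
    using K L by (simp_all add: A_def B_def closed_circle_of_vimage)
  have shift: "circle_of (x + of_int p) = circle_of x" for x p
    by (simp add: circle_of_eq_iff)
  have "A \<inter> B = {}"
    using disj by (auto simp: A_def B_def)
  then obtain \<delta> where \<delta>: "\<delta> > 0" "\<And>x y. x \<in> A \<Longrightarrow> y \<in> B \<Longrightarrow> \<delta> \<le> \<bar>x - y\<bar>"
    by (rule closed_periodic_sets_apart[OF closed]) (auto simp: A_def B_def shift)
  have inv: "(F ^^ m) x \<in> A \<longleftrightarrow> x \<in> A" "(F ^^ m) x \<in> B \<longleftrightarrow> x \<in> B" for m x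
  proof -
    have *: "(k ^^ m) \<theta> \<in> M \<longleftrightarrow> \<theta> \<in> M" if "k ` M = M" for M \<theta>
    proof (induction m)
      case (Suc m)
      have "k ((k ^^ m) \<theta>) \<in> M \<longleftrightarrow> (k ^^ m) \<theta> \<in> M"
        using inj_image_mem_iff[OF inj, of _ M] that by simp
      with Suc show ?case by simp
    qed simp
    show "(F ^^ m) x \<in> A \<longleftrightarrow> x \<in> A" "(F ^^ m) x \<in> B \<longleftrightarrow> x \<in> B"
      using *[OF K(3)] *[OF L(3)] by (simp_all add: A_def B_def circle_of_funpow)
  qed
  obtain x where x: "x \<in> A"
    using K(2) surj_image_vimage_eq[OF surj_circle_of, of K] unfolding A_def by blast
  obtain b0 where "b0 \<in> B"
    using L(2) surj_image_vimage_eq[OF surj_circle_of, of L] unfolding B_def by blast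
  then have "b0 + of_int (\<lfloor>x - b0\<rfloor>) \<in> B \<inter> {..x}"
    by (simp add: B_def shift) linarith
  then have ne: "B \<inter> {..x} \<noteq> {}"
    by blast
  define a where "a = Sup (B \<inter> {..x})"
  have bdd: "bdd_above (B \<inter> {..x})"
    by auto
  have "a \<in> B \<inter> {..x}"
    unfolding a_def using closed ne bdd by (intro closed_contains_Sup) auto
  then have a: "a \<in> B" "a < x"
    using x \<open>A \<inter> B = {}\<close> by (auto simp: less_le)
  have gap: "z \<notin> B" if "a < z" "z \<le> x" for z
    using cSup_upper[OF _ bdd, of z] that by (auto simp: a_def)
  have gap_image: "z \<notin> B" if z: "(F ^^ m) a < z" "z < (F ^^ m) a + \<delta>" for m z
  proof -
    have "(F ^^ m) a < (F ^^ m) x"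
      using a strict_mono_funpow[of m] by (simp add: strict_mono_def)
    moreover have "\<delta> \<le> \<bar>(F ^^ m) x - (F ^^ m) a\<bar>"
      using \<delta>(2) x a by (simp add: inv)
    ultimately have "z \<le> (F ^^ m) x"
      using z by simp
    \<comment> \<open>The gap after \<open>F\<^sup>m a\<close> is covered by the image of the interval from \<open>a\<close> to \<open>x\<close>.\<close>
    then have "\<exists>w\<ge>a. w \<le> x \<and> (F ^^ m) w = z"
      using z a continuous_funpow by (intro IVT') auto
    then obtain w where w: "a \<le> w" "w \<le> x" "(F ^^ m) w = z"
      by blast
    moreover have "w \<noteq> a"
      using w z by auto
    ultimately have "w \<notin> B"
      by (intro gap) auto
    then show ?thesis
      using inv(2)[of m w] w by simp
  qed
  \<comment> \<open>The orbit of \<open>a\<close>, translated into the unit interval by integers.\<close>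
  define y where "y m = frac ((F ^^ m) a)" for m
  have y_eq: "y m = (F ^^ m) a + of_int (- \<lfloor>(F ^^ m) a\<rfloor>)" for m
    by (simp add: y_def frac_def)
  have far: "\<not> (y l < y m \<and> y m < y l + \<delta>)" for l m
  proof
    assume *: "y l < y m \<and> y m < y l + \<delta>"
    have "y m + of_int \<lfloor>(F ^^ l) a\<rfloor> \<in> B"
      using inv(2)[of m a] a by (simp add: B_def y_eq circle_of_eq_iff shift del: of_int_minus)
    moreover have "y m + of_int \<lfloor>(F ^^ l) a\<rfloor> \<notin> B"
      using * by (intro gap_image[of l]) (simp_all add: y_eq[of l])
    ultimately show False by contradiction
  qed
  have "bounded (range y)"
    by (rule bounded_subset[of "{0..1}"]) (auto simp: y_def less_imp_le[OF frac_lt_1])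
  then obtain l m where "l < m" and lm: "\<bar>y m - y l\<bar> < \<delta>"
    using no_sequence_of_separated_points \<open>\<delta> > 0\<close> by blast
  then have "y m = y l"
    using far[of l m] far[of m l] by (cases "y m" "y l" rule: linorder_cases) auto
  then have "circle_of ((F ^^ m) a) = circle_of ((F ^^ l) a)"
    using shift[of "(F ^^ m) a"] shift[of "(F ^^ l) a"] by (metis y_eq)
  then show False
    using irr rational_if_orbit_repeats[OF \<open>l < m\<close>] by (simp add: circle_of_funpow)
qed

end

section \<open>The universal property of a presentation\<close>

definition word_value :: "('c, 'd) monoid_scheme \<Rightarrow> ('g \<Rightarrow> 'c) \<Rightarrow> 'g gword \<Rightarrow> 'c"
  where "word_value G s w =
    foldr (\<lambda>(g, e) x. (if e then s g else inv\<^bsub>G\<^esub> s g) \<otimes>\<^bsub>G\<^esub> x) w \<one>\<^bsub>G\<^esub>"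

locale generator_assignment = group G for G (structure) +
  fixes s :: "'g \<Rightarrow> 'a" and R :: "('g gword \<times> 'g gword) set"
  assumes s_closed: "\<And>g. s g \<in> carrier G"
    and relations_hold: "\<And>l r. (l, r) \<in> R \<Longrightarrow> word_value G s l = word_value G s r"
begin

lemma word_value_closed: "word_value G s w \<in> carrier G"
  by (induction w) (auto simp: word_value_def s_closed)

lemma word_value_append: "word_value G s (u @ v) = word_value G s u \<otimes> word_value G s v"
proof (induction u)
  case Nil
  then show ?case using word_value_closed[of v] by (simp add: word_value_def)
next
  case (Cons a u)
  then show ?case
    using word_value_closed[of u] word_value_closed[of v]
    by (cases a) (simp add: word_value_def m_assoc s_closed)
qed

lemma word_value_cong: "word_eq R u v \<Longrightarrow> word_value G s u = word_value G s v"
proof (induction rule: word_eq.induct)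
  case (cancel u g e v)
  have "word_value G s [(g, e), (g, \<not> e)] = \<one>"
    by (cases e) (simp_all add: word_value_def s_closed)
  then show ?case
    using word_value_append[of "[(g, e), (g, \<not> e)]" v]
    by (simp only: word_value_append) (simp add: word_value_closed)
next
  case (relation l r u v)
  then show ?case
    by (simp add: word_value_append relations_hold)
qed auto

lemma word_value_in_generate: "word_value G s w \<in> generate G (range s)"
proof (induction w)
  case (Cons a w)
  then show ?case
    by (cases a) (auto simp: word_value_def intro: generate.intros)
qed (simp add: word_value_def generate.one)

lemma generate_eq_word_values: "generate G (range s) = range (word_value G s)"
proof
  show "generate G (range s) \<subseteq> range (word_value G s)"
  proof
    fix x assume "x \<in> generate G (range s)"
    then show "x \<in> range (word_value G s)"
    proof (induction rule: generate.induct)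
      case one
      then show ?case by (intro image_eqI[of _ _ "[]"]) (simp_all add: word_value_def)
    next
      case (incl h)
      then obtain g where "h = s g" by blast
      then show ?case
        by (intro image_eqI[of _ _ "[(g, True)]"]) (simp_all add: word_value_def s_closed)
    next
      case (inv h)
      then obtain g where "h = s g" by blast
      then show ?case
        by (intro image_eqI[of _ _ "[(g, False)]"]) (simp_all add: word_value_def s_closed)
    next
      case (eng h1 h2)
      then obtain u v where "h1 = word_value G s u" "h2 = word_value G s v" by blast
      then show ?case
        by (intro image_eqI[of _ _ "u @ v"]) (simp_all add: word_value_append)
    qed
  qed
qed (use word_value_in_generate in blast)

text \<open>Any word in the class may be evaluated, because equivalent words have the same
  value.\<close>

definition presented_hom :: "'g gword set \<Rightarrow> 'a"
  where "presented_hom A = word_value G s (SOME w. A = word_class R w)"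

lemma presented_hom_word_class: "presented_hom (word_class R w) = word_value G s w"
proof -
  have "word_class R w = word_class R (SOME u. word_class R w = word_class R u)"
    by (rule someI[of _ w]) (rule HOL.refl)
  then have "word_eq R (SOME u. word_class R w = word_class R u) w"
    by (metis word_class_eq_iff)
  then show ?thesis
    unfolding presented_hom_def by (rule word_value_cong)
qed

lemma presented_hom_hom: "presented_hom \<in> hom (presented_group R) G"
proof (rule homI)
  fix x assume "x \<in> carrier (presented_group R)"
  then show "presented_hom x \<in> carrier G"
    using word_value_closed by (auto simp: presented_group_def presented_hom_word_class)
next
  fix x y assume "x \<in> carrier (presented_group R)" "y \<in> carrier (presented_group R)"
  then obtain u v where "x = word_class R u" "y = word_class R v"
    by (auto simp: presented_group_def)
  then show "presented_hom (x \<otimes>\<^bsub>presented_group R\<^esub> y) = presented_hom x \<otimes> presented_hom y"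
    by (simp add: mult_presented_group presented_hom_word_class word_value_append)
qed

lemma presented_hom_image: "presented_hom ` carrier (presented_group R) = generate G (range s)"
  by (simp add: generate_eq_word_values presented_group_def presented_hom_word_class image_image)

text \<open>The induced map is onto the generated subgroup, so only its kernel is at
  issue.\<close>

lemma presented_hom_iso:
  assumes "\<And>A. A \<in> carrier (presented_group R) \<Longrightarrow> presented_hom A = \<one> \<Longrightarrow> A = \<one>\<^bsub>presented_group R\<^esub>"
  shows "presented_hom \<in> iso (presented_group R) (G\<lparr>carrier := generate G (range s)\<rparr>)"
proof -
  have "inj_on presented_hom (carrier (presented_group R))"
    using inj_on_one_iff'[OF presented_hom_hom group_presented_group group_axioms] assms by blast
  moreover have "presented_hom \<in> hom (presented_group R) (G\<lparr>carrier := generate G (range s)\<rparr>)"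
    using presented_hom_hom presented_hom_image by (auto simp: hom_def)
  ultimately show ?thesis
    by (simp add: iso_iff presented_hom_image)
qed

end

lemma one_presented_group: "\<one>\<^bsub>presented_group R\<^esub> = word_class R []"
  by (simp add: presented_group_def)

lemma inv_word_class_letter:
  "inv\<^bsub>presented_group R\<^esub> (word_class R [(g, True)]) = word_class R [(g, False)]"
proof (rule group.inv_equality[OF group_presented_group])
  show "word_class R [(g, False)] \<otimes>\<^bsub>presented_group R\<^esub> word_class R [(g, True)] = \<one>\<^bsub>presented_group R\<^esub>"
    using word_eq.cancel[of R "[]" g False "[]"]
    by (simp add: mult_presented_group one_presented_group word_class_eq_iff)
qed (auto simp: presented_group_def)

lemma presented_group_generated:
  "carrier (presented_group R) = generate (presented_group R) (range (\<lambda>g. word_class R [(g, True)]))"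
  (is "_ = generate ?P ?S")
proof
  interpret P: group ?P by (rule group_presented_group)
  show "generate ?P ?S \<subseteq> carrier ?P"
    by (rule P.generate_incl) (auto simp: presented_group_def)
  have letter: "word_class R [(g, e)] \<in> generate ?P ?S" for g e
    using generate.incl[of "word_class R [(g, True)]" ?S ?P]
      generate.inv[of "word_class R [(g, True)]" ?S ?P]
    by (cases e) (auto simp: inv_word_class_letter)
  have "word_class R w \<in> generate ?P ?S" for w
  proof (induction w)
    case Nil
    then show ?case using generate.one[of ?P ?S] by (simp add: one_presented_group)
  next
    case (Cons x w)
    then show ?case
      using generate.eng[OF letter[of "fst x" "snd x"] Cons] by (simp add: mult_presented_group)
  qed
  then show "carrier ?P \<subseteq> generate ?P ?S"
    by (auto simp: presented_group_def)
qed

section \<open>Normal forms under the Baumslag--Solitar relation\<close>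

text \<open>Any pair of elements that satisfies the Baumslag--Solitar relation, in an arbitrary
  group. The elements that it generates can be brought into the form
  \<open>a\<^bsup>-i\<^esup> b\<^bsup>m\<^esup> a\<^bsup>j\<^esup>\<close>.\<close>

locale bs_relation = group G for G (structure) +
  fixes n :: nat and a b :: 'a
  assumes a [simp]: "a \<in> carrier G" and b [simp]: "b \<in> carrier G"
    and relation: "a \<otimes> b \<otimes> inv a = b [^] n"
begin

text \<open>Conjugation by \<open>a\<close> is a homomorphism, so the relation passes from
  \<open>b\<close> to its powers.\<close>

lemma a_int_pow_b: "a \<otimes> b [^] (m::int) = b [^] (int n * m) \<otimes> a"
proof -
  have "b [^] (int n * m) = (a \<otimes> b \<otimes> inv a) [^] m"
    by (simp add: relation int_pow_pow flip: int_pow_int)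
  also have "\<dots> = a \<otimes> b [^] m \<otimes> inv a"
  proof -
    have "(a \<otimes> b \<otimes> inv a) [^] (j::nat) = a \<otimes> b [^] j \<otimes> inv a" for j
    proof (induction j)
      case (Suc j)
      have "(a \<otimes> b \<otimes> inv a) [^] Suc j = a \<otimes> b [^] j \<otimes> inv a \<otimes> (a \<otimes> b \<otimes> inv a)"
        by (simp only: nat_pow_Suc Suc)
      also have "\<dots> = a \<otimes> b [^] j \<otimes> (inv a \<otimes> a) \<otimes> b \<otimes> inv a"
        by (simp only: m_assoc a b inv_closed m_closed nat_pow_closed)
      finally show ?case by (simp add: m_assoc)
    qed simp
    note nat = this
    have inv: "inv (a \<otimes> b [^] (j::nat) \<otimes> inv a) = a \<otimes> inv (b [^] j) \<otimes> inv a" for j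
      by (simp add: inv_mult_group m_assoc)
    show ?thesis
      by (cases m rule: int_cases2)
         (simp_all only: int_pow_int int_pow_neg_int nat inv a b m_closed inv_closed)
  qed
  finally show ?thesis
    by (simp add: m_assoc)
qed

lemma a_pow_int_pow_b: "a [^] (i::nat) \<otimes> b [^] (m::int) = b [^] (int n ^ i * m) \<otimes> a [^] i"
proof (induction i arbitrary: m)
  case 0
  show ?case by (simp only: nat_pow_0 power_0 mult_1 l_one r_one int_pow_closed b)
next
  case (Suc i)
  have "a [^] Suc i \<otimes> b [^] m = a [^] i \<otimes> (a \<otimes> b [^] m)"
    by (simp add: m_assoc)
  also have "\<dots> = (a [^] i \<otimes> b [^] (int n * m)) \<otimes> a"
    by (simp add: a_int_pow_b m_assoc)
  also have "\<dots> = (b [^] (int n ^ i * (int n * m)) \<otimes> a [^] i) \<otimes> a"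
    by (simp only: Suc)
  also have "\<dots> = b [^] (int n ^ Suc i * m) \<otimes> a [^] Suc i"
    by (simp add: m_assoc mult.left_commute mult.assoc)
  finally show ?case .
qed

lemma int_pow_b_inv_a_pow: "b [^] (m::int) \<otimes> inv (a [^] (i::nat)) = inv (a [^] i) \<otimes> b [^] (int n ^ i * m)"
proof -
  have "b [^] m \<otimes> inv (a [^] i) = inv (a [^] i) \<otimes> (a [^] i \<otimes> b [^] m) \<otimes> inv (a [^] i)"
    by (simp flip: m_assoc)
  also have "\<dots> = inv (a [^] i) \<otimes> (b [^] (int n ^ i * m) \<otimes> a [^] i) \<otimes> inv (a [^] i)"
    by (simp only: a_pow_int_pow_b)
  also have "\<dots> = inv (a [^] i) \<otimes> b [^] (int n ^ i * m)"
    by (simp add: m_assoc)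
  finally show ?thesis .
qed

definition normal_form :: "nat \<Rightarrow> int \<Rightarrow> nat \<Rightarrow> 'a"
  where "normal_form i m j = inv (a [^] i) \<otimes> b [^] m \<otimes> a [^] j"

lemma normal_form_closed [simp]: "normal_form i m j \<in> carrier G"
  by (simp add: normal_form_def)

lemma inv_a_normal_form: "inv a \<otimes> normal_form i m j = normal_form (Suc i) m j"
  by (simp add: normal_form_def inv_mult_group m_assoc)

lemma a_normal_form_Suc: "a \<otimes> normal_form (Suc i) m j = normal_form i m j"
  by (simp add: inv_a_normal_form[symmetric] m_assoc[symmetric])

lemma a_normal_form_0: "a \<otimes> normal_form 0 m j = normal_form 0 (int n * m) (Suc j)"
proof -
  have "a \<otimes> (b [^] m \<otimes> a [^] j) = b [^] (int n * m) \<otimes> (a \<otimes> a [^] j)"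
    by (simp add: a_int_pow_b flip: m_assoc)
  moreover have "a \<otimes> a [^] j = a [^] Suc j"
    using nat_pow_mult[of a 1 j] by simp
  ultimately show ?thesis
    by (simp add: normal_form_def)
qed

lemma b_normal_form: "b [^] (l::int) \<otimes> normal_form i m j = normal_form i (int n ^ i * l + m) j"
proof -
  have "b [^] l \<otimes> normal_form i m j = (b [^] l \<otimes> inv (a [^] i)) \<otimes> (b [^] m \<otimes> a [^] j)"
    by (simp add: normal_form_def m_assoc)
  also have "\<dots> = inv (a [^] i) \<otimes> (b [^] (int n ^ i * l) \<otimes> b [^] m) \<otimes> a [^] j"
    by (simp add: int_pow_b_inv_a_pow m_assoc)
  finally show ?thesis
    by (simp add: normal_form_def int_pow_mult)
qed

text \<open>The set of normal forms contains \<open>\<one>\<close> and is stable under left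
  multiplication by the generators and their inverses. A power of \<open>b\<close> crosses
  \<open>a\<^bsup>-i\<^esup>\<close> at the price of a factor \<open>n\<^bsup>i\<^esup>\<close> in
  its exponent. The delicate case is \<open>a\<close> times a normal form with
  \<open>i = 0\<close>: there is no \<open>a\<^bsup>-1\<^esup>\<close> to cancel, and
  \<open>a\<close> is moved to the right across the power of \<open>b\<close> instead.\<close>

lemma generate_normal_form:
  assumes "x \<in> generate G {a, b}"
  obtains i m j where "x = normal_form i m j"
proof -
  \<comment> \<open>Multiplying an arbitrary normal form makes the induction pass through products.\<close>
  have "\<exists>i' m' j'. x \<otimes> normal_form i m j = normal_form i' m' j'" for i m j
    using assms
  proof (induction arbitrary: i m j rule: generate.induct)
    case one
    have "\<one> \<otimes> normal_form i m j = normal_form i m j" by simp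
    then show ?case by blast
  next
    case (incl h)
    consider "h = a" "i = 0" | i' where "h = a" "i = Suc i'" | "h = b"
      using incl by (cases i) auto
    then show ?case
    proof cases
      case 3
      then show ?thesis using b_normal_form[of 1 i m j] by auto
    qed (use a_normal_form_0 a_normal_form_Suc in blast)+
  next
    case (inv h)
    then consider "h = a" | "h = b" by blast
    then show ?case
    proof cases
      case 1
      then show ?thesis using inv_a_normal_form by blast
    next
      case 2
      then show ?thesis using b_normal_form[of "-1" i m j] by (auto simp: int_pow_neg)
    qed
  next
    case (eng g h)
    obtain i' m' j' where "h \<otimes> normal_form i m j = normal_form i' m' j'"
      using eng.IH(2) by blast
    moreover obtain i'' m'' j'' where "g \<otimes> normal_form i' m' j' = normal_form i'' m'' j''"
      using eng.IH(1) by blast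
    moreover have "g \<in> carrier G" "h \<in> carrier G"
      using generate_in_carrier[of "{a, b}"] eng.hyps by auto
    ultimately show ?case
      by (metis m_assoc normal_form_closed)
  qed
  from this[of 0 0 0] obtain i m j where "x \<otimes> normal_form 0 0 0 = normal_form i m j" by blast
  moreover have "normal_form 0 0 0 = \<one>" "x \<in> carrier G"
    using generate_in_carrier[of "{a, b}"] assms by (auto simp: normal_form_def)
  ultimately show thesis
    using that by simp
qed

end

section \<open>The group of bijections of a type\<close>

lemma carrier_BijGroup_UNIV: "carrier (BijGroup UNIV) = {f. bij f}"
  by (auto simp: BijGroup_def Bij_def)

lemma one_BijGroup_UNIV: "\<one>\<^bsub>BijGroup UNIV\<^esub> = id"
  by (auto simp: BijGroup_def)

lemma mult_BijGroup_UNIV: "bij f \<Longrightarrow> bij g \<Longrightarrow> f \<otimes>\<^bsub>BijGroup UNIV\<^esub> g = f \<circ> g"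
  by (auto simp: BijGroup_def Bij_def compose_def fun_eq_iff)

lemma inv_BijGroup_UNIV: "bij f \<Longrightarrow> inv\<^bsub>BijGroup UNIV\<^esub> f = inv_into UNIV f"
  by (simp add: inv_BijGroup Bij_def restrict_def)

lemma bij_funpow:
  fixes f :: "'a \<Rightarrow> 'a"
  shows "bij f \<Longrightarrow> bij (f ^^ m)"
  by (induction m) (auto intro: bij_comp)

lemma nat_pow_BijGroup_UNIV: "bij f \<Longrightarrow> f [^]\<^bsub>BijGroup UNIV\<^esub> (m::nat) = f ^^ m"
proof (induction m)
  case (Suc m)
  then show ?case
    by (simp add: mult_BijGroup_UNIV bij_funpow funpow_Suc_right del: funpow.simps)
qed (simp add: one_BijGroup_UNIV)

section \<open>Iterates of the two homeomorphisms\<close>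

lemma bij_if_homeomorphic_map:
  "homeomorphic_map X X f \<Longrightarrow> topspace X = UNIV \<Longrightarrow> bij f"
  using homeomorphic_imp_injective_map homeomorphic_imp_surjective_map by (metis bij_def)

lemma bij_f0: "bij f0"
  using bij_if_homeomorphic_map[OF homeomorphic_map_f0] by simp

lemma f0_funpow: "(f0 ^^ m) (x, \<theta>) = (map_option (\<lambda>t. t + real m) x, \<theta>)"
  by (induction m) (auto simp: f0_def option.map_comp option.map_ident o_def algebra_simps)

lemma hk_funpow: "(hk n k ^^ m) (x, \<theta>) = (map_option (\<lambda>t. real n ^ m * t) x, (k ^^ m) \<theta>)"
  by (induction m) (auto simp: hk_def option.map_comp option.map_ident o_def algebra_simps)

lemma f0_int_pow: "(f0 [^]\<^bsub>BijGroup UNIV\<^esub> (m::int)) (Some t, \<theta>) = (Some (t + of_int m), \<theta>)"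
proof (cases m rule: int_cases2)
  case (nonneg j)
  then show ?thesis
    by (simp add: int_pow_int nat_pow_BijGroup_UNIV[OF bij_f0] f0_funpow)
next
  case (nonpos j)
  have "inv_into UNIV (f0 ^^ j) (Some t, \<theta>) = (Some (t - real j), \<theta>)"
    using bij_funpow[OF bij_f0] by (intro inv_f_eq) (auto simp: f0_funpow bij_def)
  then show ?thesis
    using nonpos bij_f0
    by (simp add: group.int_pow_neg_int[OF group_BijGroup] carrier_BijGroup_UNIV
        nat_pow_BijGroup_UNIV inv_BijGroup_UNIV bij_funpow)
qed

section \<open>Invariant sets of bijections\<close>

lemma orbit_subset_invariant_set:
  "invariant_set G \<phi> M \<Longrightarrow> x \<in> M \<Longrightarrow> orbit G \<phi> x \<subseteq> M"
  by (auto simp: invariant_set_def orbit_def)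

lemma image_eq_iff_invariant_both_ways:
  assumes "bij f"
  shows "f ` M = M \<longleftrightarrow> f ` M \<subseteq> M \<and> inv_into UNIV f ` M \<subseteq> M"
proof
  assume "f ` M \<subseteq> M \<and> inv_into UNIV f ` M \<subseteq> M"
  moreover from this have "f ` inv_into UNIV f ` M \<subseteq> f ` M"
    by (intro image_mono) simp
  ultimately show "f ` M = M"
    using assms by (simp add: image_f_inv_f bij_is_surj subset_antisym)
next
  assume *: "f ` M = M"
  have "inv_into UNIV f ` f ` M = M"
    using assms by (simp add: bij_is_inj image_inv_f_f)
  with * show "f ` M \<subseteq> M \<and> inv_into UNIV f ` M \<subseteq> M"
    by simp
qed

lemma image_eq_iff_mem_iff:
  assumes "bij f"
  shows "f ` M = M \<longleftrightarrow> (\<forall>x. f x \<in> M \<longleftrightarrow> x \<in> M)"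
proof
  assume "f ` M = M"
  then show "\<forall>x. f x \<in> M \<longleftrightarrow> x \<in> M"
    using inj_image_mem_iff[OF bij_is_inj[OF assms], of _ M] by simp
next
  assume *: "\<forall>x. f x \<in> M \<longleftrightarrow> x \<in> M"
  have "y \<in> f ` M" if "y \<in> M" for y
  proof -
    obtain x where "y = f x"
      using bij_is_surj[OF assms] by (rule surjE)
    then show ?thesis using * that by simp
  qed
  then show "f ` M = M"
    using * by auto
qed

text \<open>Closed invariant sets are stable under intersection, so if any two non-empty ones
  meet, they have the finite intersection property, and by compactness the intersection of all of
  them is not empty.\<close>

lemma least_closed_invariant_set:
  fixes f :: "'a::topological_space \<Rightarrow> 'a"
  assumes "compact (UNIV :: 'a set)" "bij f"
    and meet: "\<And>K L. \<lbrakk>closed K; K \<noteq> {}; f ` K = K; closed L; L \<noteq> {}; f ` L = L\<rbrakk> \<Longrightarrow> K \<inter> L \<noteq> {}"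
  obtains K where "closed K" "K \<noteq> {}" "f ` K = K"
    "\<And>L. \<lbrakk>closed L; L \<noteq> {}; f ` L = L\<rbrakk> \<Longrightarrow> K \<subseteq> L"
proof -
  define \<K> where "\<K> = {K. closed K \<and> K \<noteq> {} \<and> f ` K = K}"
  have inv: "f ` \<Inter>\<B> = \<Inter>\<B>" if "\<B> \<subseteq> \<K>" for \<B>
    using that by (auto simp: image_eq_iff_mem_iff[OF \<open>bij f\<close>] \<K>_def)
  have "\<Inter>\<B> \<in> \<K>" if "finite \<B>" "\<B> \<subseteq> \<K>" for \<B>
    using that
  proof (induction \<B> rule: finite_induct)
    case empty
    then show ?case using bij_is_surj[OF \<open>bij f\<close>] by (simp add: \<K>_def)
  next
    case (insert K \<B>)
    then have "K \<inter> \<Inter>\<B> \<noteq> {}"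
      by (intro meet) (auto simp: \<K>_def)
    moreover have "closed (\<Inter>(insert K \<B>))"
      using insert.prems by (intro closed_Inter) (auto simp: \<K>_def)
    ultimately show ?case
      using inv[OF insert.prems] by (simp add: \<K>_def)
  qed
  then have "UNIV \<inter> \<Inter>\<B> \<noteq> {}" if "finite \<B>" "\<B> \<subseteq> \<K>" for \<B>
    using that by (auto simp: \<K>_def)
  then have "UNIV \<inter> \<Inter>\<K> \<noteq> {}"
    using assms(1) unfolding compact_fip by (auto simp: \<K>_def)
  moreover have "closed (\<Inter>\<K>)"
    by (intro closed_Inter) (auto simp: \<K>_def)
  ultimately show thesis
    using that[of "\<Inter>\<K>"] inv[of \<K>] by (auto simp: \<K>_def)
qed

section \<open>Closed subsets of the torus\<close>

lemma closed_fiber_at_infinity: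
  assumes "closedin torus M"
  shows "closed {\<theta>. (pt_infinity, \<theta>) \<in> M}"
proof -
  have "continuous_map euclidean torus (\<lambda>\<theta>::circle. (pt_infinity, \<theta>))"
    unfolding torus_def by (intro continuous_map_pairedI) simp_all
  from closedin_continuous_map_preimage[OF this assms] show ?thesis
    by simp
qed

lemma closedin_torus_at_infinity:
  assumes "closed K"
  shows "closedin torus ({pt_infinity} \<times> K)"
proof -
  have "UNIV - {None} = range (Some :: real \<Rightarrow> real option)"
    by (auto simp: UNIV_option_conv)
  then have "closedin (Alexandroff_compactification (euclidean :: real topology)) {None}"
    by (simp add: closedin_def flip: UNIV_option_conv)
  then show ?thesis
    using assms by (simp add: torus_def closedin_prod_Times_iff)
qed

text \<open>Under \<open>f0\<close> a point \<open>(t, \<theta>)\<close> moves through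
  \<open>(t + m, \<theta>)\<close> towards \<open>(\<infinity>, \<theta>)\<close>: the translates
  \<open>t + m\<close> leave every compact set of the line, and the complements of
  compact sets, with \<open>\<infinity>\<close> added, are its open neighbourhoods.\<close>

lemma closed_f0_invariant_meets_infinity:
  assumes "closedin torus M" "f0 ` M = M" "(x, \<theta>) \<in> M"
  shows "(pt_infinity, \<theta>) \<in> M"
proof (cases x)
  case (Some t)
  show ?thesis
  proof (rule ccontr)
    assume not_in: "(pt_infinity, \<theta>) \<notin> M"
    have iterates: "(f0 ^^ m) (x, \<theta>) \<in> M" for m
      using assms(2,3) by (induction m) auto
    have "continuous_map (Alexandroff_compactification euclidean) torus (\<lambda>y. (y, \<theta>))"
      unfolding torus_def by (intro continuous_map_pairedI) simp_all
    moreover have "openin torus (UNIV - M)"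
      using assms(1) by (simp add: closedin_def)
    ultimately have "openin (Alexandroff_compactification euclidean) {y. (y, \<theta>) \<notin> M}"
      using openin_continuous_map_preimage by (fastforce simp flip: UNIV_option_conv)
    then obtain C where "compact C" and C: "{y. (y, \<theta>) \<notin> M} = insert None (Some ` (UNIV - C))"
      using not_in by (auto simp: openin_Alexandroff_compactification)
    obtain B where B: "\<And>y. y \<in> C \<Longrightarrow> \<bar>y\<bar> \<le> B"
      using compact_imp_bounded[OF \<open>compact C\<close>] by (auto simp: bounded_real)
    obtain m where "B - t < real m"
      using reals_Archimedean2 by blast
    then have "t + real m \<notin> C"
      using B[of "t + real m"] by auto
    then have "Some (t + real m) \<in> {y. (y, \<theta>) \<notin> M}"
      unfolding C by blast
    then show False
      using iterates[of m] by (simp add: Some f0_funpow)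
  qed
qed (use assms in simp)

section \<open>The action on the torus\<close>

locale torus_action =
  fixes n :: nat and k :: "circle \<Rightarrow> circle"
  assumes n: "n \<ge> 2" and k: "homeomorphic_map euclidean euclidean k"
begin

lemma bij_k: "bij k"
  using bij_if_homeomorphic_map[OF k] by simp

lemma bij_hk: "bij (hk n k)"
  using bij_if_homeomorphic_map[OF homeomorphic_map_hk[OF k]] n by simp

text \<open>On the first factor this is \<open>n * (x + 1) = n * x + n\<close>; the second factor
  is not moved by \<open>f0\<close>.\<close>

lemma hk_conjugates_f0: "hk n k \<circ> f0 = (f0 ^^ n) \<circ> hk n k"
  by (auto simp: fun_eq_iff hk_def f0_def f0_funpow[unfolded f0_def] option.map_comp o_def algebra_simps)

definition generator :: "bs_gen \<Rightarrow> real option \<times> circle \<Rightarrow> real option \<times> circle"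
  where "generator g = (case g of BS_a \<Rightarrow> hk n k | BS_b \<Rightarrow> f0)"

lemma range_generator: "range generator = {f0, hk n k}"
  by (auto simp: generator_def image_iff split: bs_gen.splits intro: exI[of _ BS_a] exI[of _ BS_b])

lemma torus_group_eq:
  "torus_group n k = (BijGroup UNIV)\<lparr>carrier := generate (BijGroup UNIV) (range generator)\<rparr>"
  by (simp add: torus_group_def range_generator)

definition bs_relations :: "(bs_gen gword \<times> bs_gen gword) set"
  where "bs_relations = {([(BS_a, True), (BS_b, True), (BS_a, False)], replicate n (BS_b, True))}"

sublocale generator_assignment "BijGroup UNIV" generator bs_relations
proof (intro generator_assignment.intro generator_assignment_axioms.intro)
  interpret B: group "BijGroup (UNIV :: (real option \<times> circle) set)"
    by (rule group_BijGroup)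
  show "group (BijGroup (UNIV :: (real option \<times> circle) set))"
    by (rule group_BijGroup)
  show closed: "generator g \<in> carrier (BijGroup UNIV)" for g
    by (cases g) (simp_all add: generator_def carrier_BijGroup_UNIV bij_f0 bij_hk)
  have "word_value (BijGroup UNIV) generator (replicate m (BS_b, True)) = f0 ^^ m" for m
    by (induction m)
       (simp_all add: word_value_def generator_def one_BijGroup_UNIV mult_BijGroup_UNIV bij_f0 bij_funpow)
  moreover have "hk n k \<circ> (f0 \<circ> inv_into UNIV (hk n k)) = f0 ^^ n"
    using hk_conjugates_f0 bij_hk by (metis bij_def comp_assoc comp_id surj_iff)
  ultimately show "word_value (BijGroup UNIV) generator l = word_value (BijGroup UNIV) generator r"
    if "(l, r) \<in> bs_relations" for l r
    using that
    by (simp add: bs_relations_def word_value_def generator_def one_BijGroup_UNIV mult_BijGroup_UNIV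
        inv_BijGroup_UNIV bij_f0 bij_hk bij_imp_bij_inv bij_comp)
qed

lemma UNIV_bs_gen: "UNIV = {BS_a, BS_b}"
  using bs_gen.exhaust by auto

lemma BS1_eq: "BS1 n = presented_group bs_relations"
  by (simp add: BS1_def bs_relations_def)

lemma bs_relation_presented_group:
  "bs_relation (presented_group bs_relations) n
     (word_class bs_relations [(BS_a, True)]) (word_class bs_relations [(BS_b, True)])"
proof (intro bs_relation.intro bs_relation_axioms.intro group_presented_group)
  have pow: "word_class bs_relations [(BS_b, True)] [^]\<^bsub>presented_group bs_relations\<^esub> (m::nat)
      = word_class bs_relations (replicate m (BS_b, True))" for m
    by (induction m)
       (simp_all add: one_presented_group mult_presented_group nat_pow_def replicate_append_same)
  have "word_eq bs_relations [(BS_a, True), (BS_b, True), (BS_a, False)] (replicate n (BS_b, True))"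
    using word_eq.relation[of _ _ bs_relations "[]" "[]"] by (simp add: bs_relations_def)
  then show "word_class bs_relations [(BS_a, True)]
        \<otimes>\<^bsub>presented_group bs_relations\<^esub> word_class bs_relations [(BS_b, True)]
        \<otimes>\<^bsub>presented_group bs_relations\<^esub> inv\<^bsub>presented_group bs_relations\<^esub> word_class bs_relations [(BS_a, True)]
      = word_class bs_relations [(BS_b, True)] [^]\<^bsub>presented_group bs_relations\<^esub> n"
    unfolding pow inv_word_class_letter mult_presented_group by (simp add: word_class_eq_iff)
qed (auto simp: presented_group_def)

text \<open>The affine action on the first factor is already faithful. If
  \<open>a\<^bsup>-i\<^esup> b\<^bsup>m\<^esup> a\<^bsup>j\<^esup>\<close> acts trivially, then
  \<open>n\<^bsup>i\<^esup> t = n\<^bsup>j\<^esup> t + m\<close> for all real \<open>t\<close>.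
  The values at \<open>t = 0\<close> and \<open>t = 1\<close> give \<open>m = 0\<close> and
  \<open>i = j\<close>.\<close>

lemma presented_hom_kernel:
  assumes A: "A \<in> carrier (presented_group bs_relations)" and "presented_hom A = \<one>\<^bsub>BijGroup UNIV\<^esub>"
  shows "A = \<one>\<^bsub>presented_group bs_relations\<^esub>"
proof -
  let ?a = "word_class bs_relations [(BS_a, True)]" and ?b = "word_class bs_relations [(BS_b, True)]"
  interpret P: bs_relation "presented_group bs_relations" n ?a ?b
    by (rule bs_relation_presented_group)
  interpret \<phi>: group_hom "presented_group bs_relations" "BijGroup UNIV" presented_hom
    by (intro group_hom.intro group_hom_axioms.intro group_presented_group group_BijGroup presented_hom_hom)
  have "range (\<lambda>g. word_class bs_relations [(g, True)]) = {?a, ?b}"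
    by (force simp: UNIV_bs_gen)
  then have "A \<in> generate (presented_group bs_relations) {?a, ?b}"
    using A presented_group_generated[of bs_relations] by simp
  then obtain i m j where nf: "A = P.normal_form i m j"
    by (rule P.generate_normal_form)
  have gens: "presented_hom ?a = hk n k" "presented_hom ?b = f0"
    by (simp_all add: presented_hom_word_class word_value_def generator_def
        one_BijGroup_UNIV mult_BijGroup_UNIV bij_f0 bij_hk)
  \<comment> \<open>Multiplying by the power of \<open>a\<close> first avoids inverses of the dilation on the torus.\<close>
  have "?a [^]\<^bsub>presented_group bs_relations\<^esub> i \<otimes>\<^bsub>presented_group bs_relations\<^esub> A
      = ?b [^]\<^bsub>presented_group bs_relations\<^esub> m \<otimes>\<^bsub>presented_group bs_relations\<^esub> ?a [^]\<^bsub>presented_group bs_relations\<^esub> j"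
    by (simp add: nf P.normal_form_def flip: P.m_assoc)
  then have "presented_hom (?a [^]\<^bsub>presented_group bs_relations\<^esub> i \<otimes>\<^bsub>presented_group bs_relations\<^esub> A)
      = presented_hom (?b [^]\<^bsub>presented_group bs_relations\<^esub> m \<otimes>\<^bsub>presented_group bs_relations\<^esub> ?a [^]\<^bsub>presented_group bs_relations\<^esub> j)"
    by simp
  moreover have "hk n k [^]\<^bsub>BijGroup UNIV\<^esub> i \<otimes>\<^bsub>BijGroup UNIV\<^esub> \<one>\<^bsub>BijGroup UNIV\<^esub>
      = hk n k [^]\<^bsub>BijGroup UNIV\<^esub> i"
    by (intro r_one nat_pow_closed) (simp add: carrier_BijGroup_UNIV bij_hk)
  ultimately have "hk n k [^]\<^bsub>BijGroup UNIV\<^esub> i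
      = f0 [^]\<^bsub>BijGroup UNIV\<^esub> m \<otimes>\<^bsub>BijGroup UNIV\<^esub> hk n k [^]\<^bsub>BijGroup UNIV\<^esub> j"
    using assms \<phi>.hom_nat_pow[of ?a] \<phi>.hom_int_pow[of ?b] gens
    by (simp add: carrier_BijGroup_UNIV bij_hk)
  moreover have "bij (f0 [^]\<^bsub>BijGroup UNIV\<^esub> m)"
    using int_pow_closed[of f0 m] by (simp add: carrier_BijGroup_UNIV bij_f0)
  ultimately have eq: "hk n k ^^ i = (f0 [^]\<^bsub>BijGroup UNIV\<^esub> m) \<circ> (hk n k ^^ j)"
    by (simp add: nat_pow_BijGroup_UNIV bij_hk bij_funpow mult_BijGroup_UNIV)
  have "real n ^ i * t = real n ^ j * t + of_int m" for t
    using fun_cong[OF eq, of "(Some t, undefined)"] by (simp add: hk_funpow f0_int_pow)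
  from this[of 0] this[of 1] have "m = 0" "real n ^ i = real n ^ j"
    by simp_all
  moreover from this(2) have "i = j"
    using n by (simp add: power_inject_exp)
  ultimately show ?thesis
    by (simp add: nf P.normal_form_def)
qed

lemma torus_group_iso_BS1: "torus_group n k \<cong> BS1 n"
proof -
  have "presented_group bs_relations \<cong> torus_group n k"
    using presented_hom_iso[OF presented_hom_kernel] by (auto simp: is_iso_def torus_group_eq)
  then show ?thesis
    unfolding BS1_eq by (rule group.iso_sym[OF group_presented_group])
qed

text \<open>Since the group contains the inverses of the generators, invariance under it is
  equality, not mere inclusion, of the images under the generators.\<close>

lemma invariant_set_iff:
  "invariant_set (torus_group n k) (\<lambda>g. g) M \<longleftrightarrow> f0 ` M = M \<and> hk n k ` M = M"
proof
  let ?B = "BijGroup (UNIV :: (real option \<times> circle) set)"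
  have carrier: "carrier (torus_group n k) = generate ?B {f0, hk n k}"
    by (simp add: torus_group_def)
  {
    assume inv: "invariant_set (torus_group n k) (\<lambda>g. g) M"
    have "g ` M = M" if "g \<in> {f0, hk n k}" for g
    proof -
      have "bij g" using that bij_f0 bij_hk by auto
      moreover have "g \<in> carrier (torus_group n k)" "inv\<^bsub>?B\<^esub> g \<in> carrier (torus_group n k)"
        using that unfolding carrier by (auto intro: generate.incl generate.inv)
      ultimately show ?thesis
        using inv by (simp add: image_eq_iff_invariant_both_ways inv_BijGroup_UNIV invariant_set_def)
    qed
    then show "f0 ` M = M \<and> hk n k ` M = M" by simp
  next
    assume eq: "f0 ` M = M \<and> hk n k ` M = M"
    have "bij g \<and> g ` M = M" if "g \<in> generate ?B {f0, hk n k}" for g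
      using that
    proof (induction rule: generate.induct)
      case one
      then show ?case by (simp add: one_BijGroup_UNIV bij_id[unfolded id_def] id_def)
    next
      case (incl h)
      then show ?case using eq bij_f0 bij_hk by auto
    next
      case (inv h)
      then have h: "bij h" "h ` M = M" using eq bij_f0 bij_hk by auto
      then have "inv_into UNIV h ` M = M"
        by (metis bij_is_inj image_inv_f_f)
      with h show ?case by (simp add: inv_BijGroup_UNIV bij_imp_bij_inv)
    next
      case (eng g h)
      then have "bij (g \<circ> h)" "(g \<circ> h) ` M = M"
        by (auto intro: bij_comp simp del: comp_apply simp flip: image_comp)
      moreover have "g \<otimes>\<^bsub>?B\<^esub> h = g \<circ> h"
        using eng by (simp only: mult_BijGroup_UNIV)
      ultimately show ?case by (simp only: simp_thms)
    qed
    then show "invariant_set (torus_group n k) (\<lambda>g. g) M"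
      by (simp add: invariant_set_def carrier)
  }
qed

text \<open>On the circle at infinity \<open>f0\<close> is the identity and \<open>hk n k\<close>
  is \<open>k\<close>, so there the action is that of the powers of \<open>k\<close>.\<close>

lemma invariant_at_infinity_iff:
  "invariant_set (torus_group n k) (\<lambda>g. g) ({pt_infinity} \<times> K) \<longleftrightarrow> k ` K = K"
proof -
  have "f0 ` ({pt_infinity} \<times> K) = {pt_infinity} \<times> K"
    "hk n k ` ({pt_infinity} \<times> K) = {pt_infinity} \<times> k ` K"
    by (force simp: f0_def hk_def)+
  then show ?thesis
    by (auto simp: invariant_set_iff times_eq_iff)
qed

lemma fiber_at_infinity_invariant:
  assumes "invariant_set (torus_group n k) (\<lambda>g. g) M"
  shows "k ` {\<theta>. (pt_infinity, \<theta>) \<in> M} = {\<theta>. (pt_infinity, \<theta>) \<in> M}"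
proof -
  have "\<forall>z. hk n k z \<in> M \<longleftrightarrow> z \<in> M"
    using assms by (simp add: invariant_set_iff image_eq_iff_mem_iff[OF bij_hk])
  then have "(pt_infinity, k \<theta>) \<in> M \<longleftrightarrow> (pt_infinity, \<theta>) \<in> M" for \<theta>
    by (metis (no_types) hk_def case_prod_conv option.map(1))
  then show ?thesis
    by (simp add: image_eq_iff_mem_iff[OF bij_k])
qed

lemma funpow_in_orbit:
  assumes "g \<in> {f0, hk n k}"
  shows "(g ^^ m) z \<in> orbit (torus_group n k) (\<lambda>g. g) z"
proof -
  have "bij g" using assms bij_f0 bij_hk by auto
  have "g ^^ m \<in> generate (BijGroup UNIV) {f0, hk n k}"
  proof (induction m)
    case 0
    then show ?case using generate.one[of "BijGroup UNIV" "{f0, hk n k}"] by (simp add: one_BijGroup_UNIV id_def)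
  next
    case (Suc m)
    have "g \<otimes>\<^bsub>BijGroup UNIV\<^esub> g ^^ m \<in> generate (BijGroup UNIV) {f0, hk n k}"
      by (intro generate.eng generate.incl assms Suc)
    then show ?case
      by (simp add: mult_BijGroup_UNIV \<open>bij g\<close> bij_funpow o_def)
  qed
  then show ?thesis
    by (auto simp: orbit_def torus_group_def)
qed

lemma finite_orbit_if_periodic:
  assumes "q > 0" "(k ^^ q) \<theta> = \<theta>"
  shows "finite (orbit (torus_group n k) (\<lambda>g. g) (pt_infinity, \<theta>))"
proof -
  define K where "K = (\<lambda>i. (k ^^ i) \<theta>) ` {..<q}"
  have "k ((k ^^ i) \<theta>) \<in> K" if "i < q" for i
  proof (cases "Suc i = q")
    case True
    then have "k ((k ^^ i) \<theta>) = (k ^^ 0) \<theta>"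
      using assms by auto
    then show ?thesis using \<open>q > 0\<close> unfolding K_def by blast
  next
    case False
    with that have "Suc i < q" by simp
    then show ?thesis unfolding K_def by (intro image_eqI[of _ _ "Suc i"]) auto
  qed
  then have "k ` K \<subseteq> K" by (auto simp: K_def)
  then have "k ` K = K"
    using bij_k by (intro endo_inj_surj) (auto simp: K_def bij_def intro: inj_on_subset)
  moreover have "(k ^^ 0) \<theta> \<in> K"
    using \<open>q > 0\<close> unfolding K_def by blast
  ultimately have "orbit (torus_group n k) (\<lambda>g. g) (pt_infinity, \<theta>) \<subseteq> {pt_infinity} \<times> K"
    by (intro orbit_subset_invariant_set) (auto simp: invariant_at_infinity_iff)
  then show ?thesis
    by (rule finite_subset) (simp add: K_def)
qed

text \<open>The second coordinate of the iterates of \<open>hk n k\<close> is the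
  \<open>k\<close>-orbit of \<open>\<theta>\<close>, for finite as for infinite
  \<open>x\<close>.\<close>

lemma orbit_repeats_if_finite:
  assumes "finite (orbit (torus_group n k) (\<lambda>g. g) (x, \<theta>))"
  obtains l m where "l < m" "(k ^^ m) \<theta> = (k ^^ l) \<theta>"
proof -
  have "range (\<lambda>m. (hk n k ^^ m) (x, \<theta>)) \<subseteq> orbit (torus_group n k) (\<lambda>g. g) (x, \<theta>)"
    by (auto simp del: split_paired_All intro: funpow_in_orbit)
  then have "finite (range (\<lambda>m. (hk n k ^^ m) (x, \<theta>)))"
    using assms by (rule finite_subset)
  then have "\<not> inj (\<lambda>m. (hk n k ^^ m) (x, \<theta>))"
    using range_inj_infinite by blast
  then obtain l m where "l \<noteq> m" "(hk n k ^^ l) (x, \<theta>) = (hk n k ^^ m) (x, \<theta>)"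
    by (auto simp: inj_def)
  then have "(k ^^ l) \<theta> = (k ^^ m) \<theta>" by (simp add: hk_funpow)
  with \<open>l \<noteq> m\<close> show thesis
    using that by (metis nat_neq_iff)
qed

text \<open>Every non-empty closed invariant subset of the torus reaches the circle at infinity,
  and its trace there is a non-empty closed \<open>k\<close>-invariant set. So a least such set on
  the circle, placed at infinity, is contained in every non-empty closed invariant subset of the
  torus, which makes it the only minimal one.\<close>

lemma minimal_set_iff:
  assumes K: "closed K" "K \<noteq> {}" "k ` K = K"
    and least: "\<And>L. \<lbrakk>closed L; L \<noteq> {}; k ` L = L\<rbrakk> \<Longrightarrow> K \<subseteq> L"
  shows "minimal_set torus (torus_group n k) (\<lambda>g. g) M \<longleftrightarrow> M = {pt_infinity} \<times> K"
proof -
  let ?M = "{pt_infinity} \<times> K"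
  have M: "closedin torus ?M" "invariant_set (torus_group n k) (\<lambda>g. g) ?M" "?M \<noteq> {}"
    using K closedin_torus_at_infinity by (auto simp: invariant_at_infinity_iff)
  have below: "?M \<subseteq> N"
    if "closedin torus N" "invariant_set (torus_group n k) (\<lambda>g. g) N" "N \<noteq> {}" for N
  proof -
    obtain x \<theta> where "(x, \<theta>) \<in> N"
      using \<open>N \<noteq> {}\<close> by auto
    then have "(pt_infinity, \<theta>) \<in> N"
      using closed_f0_invariant_meets_infinity that invariant_set_iff by blast
    then have "K \<subseteq> {\<theta>. (pt_infinity, \<theta>) \<in> N}"
      using that by (intro least closed_fiber_at_infinity fiber_at_infinity_invariant) auto
    then show ?thesis by auto
  qed
  show ?thesis
    unfolding minimal_set_def using M below by blast
qed

end

section \<open>Structure, finite orbits and minimal set of the action\<close>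

theorem theorem1:
  fixes n :: nat and k :: "circle \<Rightarrow> circle"
  assumes "n \<ge> 2" and "orientation_preserving_homeo k"
  shows
    "torus_group n k \<cong> BS1 n \<and>
     (rational_class (rotation_number k) \<longrightarrow>
        (\<exists>Orb \<in> orbits (torus_group n k) (topspace torus) (\<lambda>g. g). finite Orb)) \<and>
     (\<not> rational_class (rotation_number k) \<longrightarrow>
        \<not> (\<exists>Orb \<in> orbits (torus_group n k) (topspace torus) (\<lambda>g. g). finite Orb) \<and>
        (\<exists>!M. minimal_set torus (torus_group n k) (\<lambda>g. g) M) \<and>
        (\<forall>M. minimal_set torus (torus_group n k) (\<lambda>g. g) M \<longrightarrow> M \<subseteq> {pt_infinity} \<times> UNIV) \<and>
        {pt_infinity} \<times> UNIV = fix_set f0)"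
proof -
  \<comment> \<open>The very lift that the definition of the rotation number selects.\<close>
  define F where "F = (SOME F. is_lift F k \<and> strict_mono F)"
  have F: "is_lift F k" "strict_mono F"
    using someI_ex[of "\<lambda>F. is_lift F k \<and> strict_mono F"] assms(2)
    by (auto simp: F_def orientation_preserving_homeo_def)
  interpret torus_action n k
    using assms by unfold_locales (auto simp: orientation_preserving_homeo_def)
  interpret increasing_lift F k
    using F bij_k by unfold_locales (auto simp: bij_def)
  have rational_iff: "rational_class (rotation_number k) \<longleftrightarrow> translation_number F \<in> \<rat>"
    by (simp add: rotation_number_def rational_class_circle_of flip: F_def)
  show ?thesis
  proof (intro conjI impI)
    show "torus_group n k \<cong> BS1 n"
      by (rule torus_group_iso_BS1)
  next
    assume "rational_class (rotation_number k)"
    then obtain q \<theta> where "q > 0" "(k ^^ q) \<theta> = \<theta>"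
      using periodic_point_if_rational rational_iff by blast
    then show "\<exists>Orb \<in> orbits (torus_group n k) (topspace torus) (\<lambda>g. g). finite Orb"
      using finite_orbit_if_periodic by (auto simp: orbits_def)
  next
    assume "\<not> rational_class (rotation_number k)"
    then have irr: "translation_number F \<notin> \<rat>"
      by (simp add: rational_iff)
    have "infinite (orbit (torus_group n k) (\<lambda>g. g) (x, \<theta>))" for x \<theta>
      by (auto elim!: orbit_repeats_if_finite dest: rational_if_orbit_repeats simp: irr)
    then show "\<not> (\<exists>Orb \<in> orbits (torus_group n k) (topspace torus) (\<lambda>g. g). finite Orb)"
      by (auto simp: orbits_def)
    obtain K where K: "closed K" "K \<noteq> {}" "k ` K = K"
        "\<And>L. \<lbrakk>closed L; L \<noteq> {}; k ` L = L\<rbrakk> \<Longrightarrow> K \<subseteq> L"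
      using least_closed_invariant_set[OF compact_UNIV_circle bij_k closed_invariant_sets_meet[OF irr]]
      by blast
    note minimal = minimal_set_iff[OF K]
    show "\<exists>!M. minimal_set torus (torus_group n k) (\<lambda>g. g) M"
      by (simp add: minimal)
    show "\<forall>M. minimal_set torus (torus_group n k) (\<lambda>g. g) M \<longrightarrow> M \<subseteq> {pt_infinity} \<times> UNIV"
      by (auto simp: minimal)
    show "{pt_infinity} \<times> UNIV = fix_set f0"
      by (auto simp: fix_set_def f0_def map_option_case split: option.splits)
  qed
qed

end
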